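(* Let $t\geq 1$ be an integer and let $X_1,\ldots,X_{t+1}$ be finite nonempty sets of sizes $n_1,\ldots,n_{t+1}$, respectively. Denote $$\mathcal{D}(X_1,\ldots,X_{t+1}) = \frac{1}{\prod_{s=1}^{t}n_{s+1}^{n_{s}}}\sum_{\substack{f_s\colon X_s\to X_{s+1}\\1\leq s\leq t}}\deg(f_t\circ\cdots\circ f_1),$$ where the sum is over all $t$-tuples $(f_1,\ldots,f_t)$ of functions $f_s\colon X_s\to X_{s+1}$, $1\leq s\leq t$. Then $$\mathcal{D}(X_1,\ldots,X_{t+1}) =\frac{\prod_{s=1}^{t+1}n_s-\prod_{s=1}^{t+1}(n_s-1)}{\prod_{s=2}^{t+1}n_s}.$$
   Context: For a function $f\colon X\to Y$ between two finite nonempty sets, the degree of noninvertibility of $f$ is $\deg(f)=\frac{1}{|X|}\sum_{x\in X}|f^{-1}(f(x))|$; equivalently, $\deg(f)=\frac{1}{|X|}\sum_{y\in Y}|f^{-1}(y)|^2$. Here $f^{-1}(y)=\{x\in X : f(x)=y\}$. *)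

theory Defs
  imports Complex_Main "HOL-Library.FuncSet"
begin

text \<open>The domain \<open>X\<close> is explicit, so preimages are taken inside \<open>X\<close>; the codomain
  does not enter the formula.\<close>

definition deg_noninv :: "'a set \<Rightarrow> ('a \<Rightarrow> 'b) \<Rightarrow> real" where
  "deg_noninv X f = (1 / real (card X)) * (\<Sum>x\<in>X. real (card {x' \<in> X. f x' = f x}))"

text \<open>\<open>comp_upto f t = f t \<circ> \<dots> \<circ> f 1\<close>; indexing of the tuple starts at 1.\<close>

primrec comp_upto :: "(nat \<Rightarrow> 'a \<Rightarrow> 'a) \<Rightarrow> nat \<Rightarrow> 'a \<Rightarrow> 'a" where
  "comp_upto f 0 = id"
| "comp_upto f (Suc k) = f (Suc k) \<circ> comp_upto f k"

text \<open>The sets \<open>X 1, \<dots>, X (t+1)\<close> are arbitrary subsets of one ambient type. Functions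
  from \<open>X s\<close> to \<open>X (s+1)\<close>, and tuples of them, are represented extensionally
  (\<open>undefined\<close> outside their domain), so each \<open>t\<close>-tuple occurs exactly once in the sum.\<close>

definition mean_deg :: "nat \<Rightarrow> (nat \<Rightarrow> 'a set) \<Rightarrow> real" where
  "mean_deg t X =
     (1 / (\<Prod>s=1..t. real (card (X (s+1))) ^ card (X s))) *
     (\<Sum>f \<in> (\<Pi>\<^sub>E s\<in>{1..t}. X s \<rightarrow>\<^sub>E X (s+1)). deg_noninv (X 1) (comp_upto f t))"

end

theory Submission
  imports Defs
begin

text \<open>
  By linearity, the sum of the degrees counts triples of a tuple \<open>f\<close> and two points \<open>x\<close>, \<open>y\<close> of
  \<open>X 1\<close> that the composition sends to the same point. It is easier to count the triples in which
  the two images stay distinct, because distinct images at the end have been distinct at every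
  stage. If the images are distinct after \<open>s - 1\<close> maps, a uniformly random \<open>f s\<close> keeps them
  distinct with probability \<open>1 - 1 / n (s+1)\<close>, whatever the earlier maps were; the probabilities
  multiply (\<open>sum_tuples_separating\<close>). So a pair \<open>x \<noteq> y\<close> stays distinct with probability
  \<open>P = (\<Prod>s=1..t. 1 - 1 / n (s+1))\<close>, which does not depend on the pair, while each of the \<open>n 1\<close>
  pairs \<open>x = y\<close> always collides. The mean degree is therefore
  \<open>(n 1 * n 1 - n 1 * (n 1 - 1) * P) / n 1 = n 1 - (n 1 - 1) * P\<close>, which is the stated quotient.
\<close>

text \<open>A function identifying \<open>u\<close> and \<open>v\<close> is determined, freely, by its values off \<open>v\<close>.\<close>

lemma card_funcset_identifying:
  assumes "finite A" "u \<in> A" "v \<in> A" "u \<noteq> v"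
  shows "card {h \<in> A \<rightarrow>\<^sub>E B. h u = h v} = card B ^ (card A - 1)"
proof -
  let ?A = "A - {v}"
  have "{h \<in> A \<rightarrow>\<^sub>E B. h u = h v} = (\<lambda>g. g(v := g u)) ` (?A \<rightarrow>\<^sub>E B)"
  proof (intro equalityI subsetI)
    fix h assume h: "h \<in> {h \<in> A \<rightarrow>\<^sub>E B. h u = h v}"
    have "h = (h(v := undefined))(v := (h(v := undefined)) u)"
      using h assms by auto
    moreover have "h(v := undefined) \<in> ?A \<rightarrow>\<^sub>E B"
      using h by (auto simp: PiE_iff extensional_def)
    ultimately show "h \<in> (\<lambda>g. g(v := g u)) ` (?A \<rightarrow>\<^sub>E B)"
      by blast
  next
    fix h assume "h \<in> (\<lambda>g. g(v := g u)) ` (?A \<rightarrow>\<^sub>E B)"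
    then obtain g where g: "g \<in> ?A \<rightarrow>\<^sub>E B" and h: "h = g(v := g u)"
      by blast
    have "g u \<in> B"
      using PiE_mem[OF g, of u] assms by simp
    then have "h \<in> insert v ?A \<rightarrow>\<^sub>E B"
      unfolding h using g by (intro PiE_fun_upd)
    then show "h \<in> {h \<in> A \<rightarrow>\<^sub>E B. h u = h v}"
      using assms h by (simp add: insert_absorb)
  qed
  moreover have "inj_on (\<lambda>g. g(v := g u)) (?A \<rightarrow>\<^sub>E B)"
  proof (rule inj_onI)
    fix g g' assume g: "g \<in> ?A \<rightarrow>\<^sub>E B" "g' \<in> ?A \<rightarrow>\<^sub>E B" "g(v := g u) = g'(v := g' u)"
    show "g = g'"
    proof
      fix z
      show "g z = g' z"
      proof (cases "z = v")
        case True
        then show ?thesis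
          using PiE_arb[OF g(1), of z] PiE_arb[OF g(2), of z] by simp
      next
        case False
        then show ?thesis
          using fun_cong[OF g(3), of z] by simp
      qed
    qed
  qed
  ultimately show ?thesis
    using assms by (simp add: card_image card_funcsetE)
qed

lemma sum_funcset_separating:
  assumes "finite A" "finite B" "B \<noteq> {}" "u \<in> A" "v \<in> A" "u \<noteq> v"
  shows "(\<Sum>h \<in> A \<rightarrow>\<^sub>E B. of_bool (h u \<noteq> h v)) =
    real (card B) ^ card A * (1 - 1 / real (card B))"
proof -
  have fin: "finite (A \<rightarrow>\<^sub>E B)"
    using assms by (intro finite_PiE) auto
  have B: "real (card B) \<noteq> 0"
    using assms by simp
  have "card A \<noteq> 0"
    using assms by auto
  then obtain k where k: "card A = Suc k"
    using not0_implies_Suc by blast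
  have "(\<Sum>h \<in> A \<rightarrow>\<^sub>E B. of_bool (h u \<noteq> h v)) =
      (\<Sum>h \<in> A \<rightarrow>\<^sub>E B. 1 - (of_bool (h u = h v) :: real))"
    by (intro sum.cong) auto
  also have "\<dots> = real (card B) ^ card A - real (card B) ^ (card A - 1)"
    using fin assms card_funcset_identifying[of A u v B]
    by (simp add: sum_subtractf card_funcsetE Int_def)
  also have "\<dots> = real (card B) ^ card A * (1 - 1 / real (card B))"
    using B by (simp add: k field_simps)
  finally show ?thesis .
qed

lemma sum_PiE_Suc:
  "(\<Sum>f \<in> (\<Pi>\<^sub>E s\<in>{1..Suc t}. S s). \<phi> f) =
    (\<Sum>g \<in> (\<Pi>\<^sub>E s\<in>{1..t}. S s). \<Sum>h \<in> S (Suc t). \<phi> (g(Suc t := h)))"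
proof -
  have *: "{1..Suc t} = insert (Suc t) {1..t}"
    by auto
  have "(\<Sum>f \<in> (\<Pi>\<^sub>E s\<in>{1..Suc t}. S s). \<phi> f) =
      (\<Sum>(h, g) \<in> S (Suc t) \<times> (\<Pi>\<^sub>E s\<in>{1..t}. S s). \<phi> (g(Suc t := h)))"
    unfolding * PiE_insert_eq
    by (subst sum.reindex[OF inj_combinator]) (auto simp: case_prod_unfold)
  also have "\<dots> = (\<Sum>h \<in> S (Suc t). \<Sum>g \<in> (\<Pi>\<^sub>E s\<in>{1..t}. S s). \<phi> (g(Suc t := h)))"
    by (simp add: sum.cartesian_product)
  finally show ?thesis
    by (simp add: sum.swap[of _ "S (Suc t)"])
qed

lemma comp_upto_cong:
  "(\<And>s. s \<in> {1..k} \<Longrightarrow> f s = g s) \<Longrightarrow> comp_upto f k = comp_upto g k"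
  by (induction k) auto

lemma comp_upto_in:
  assumes "\<And>s. s \<in> {1..k} \<Longrightarrow> f s \<in> X s \<rightarrow> X (s+1)" "x \<in> X 1"
  shows "comp_upto f k x \<in> X (k+1)"
  using assms(1)
proof (induction k)
  case (Suc k)
  then have "comp_upto f k x \<in> X (k+1)" "f (k+1) \<in> X (k+1) \<rightarrow> X (k+1+1)"
    by auto
  then show ?case by auto
qed (use assms in simp)

text \<open>Given that the first \<open>t\<close> maps keep \<open>x\<close> and \<open>y\<close> apart, the fraction of choices for the
  next map that does so depends only on its codomain; after a collision it is zero.\<close>

lemma sum_tuples_separating:
  assumes "\<And>s. s \<in> {1..t+1} \<Longrightarrow> finite (X s)"
    and "\<And>s. s \<in> {1..t+1} \<Longrightarrow> X s \<noteq> {}"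
    and xy: "x \<in> X 1" "y \<in> X 1" "x \<noteq> y"
  shows "(\<Sum>f \<in> (\<Pi>\<^sub>E s\<in>{1..t}. X s \<rightarrow>\<^sub>E X (s+1)). of_bool (comp_upto f t x \<noteq> comp_upto f t y)) =
    (\<Prod>s=1..t. real (card (X (s+1))) ^ card (X s)) * (\<Prod>s=1..t. 1 - 1 / real (card (X (s+1))))"
  using assms(1,2)
proof (induction t)
  case 0
  then show ?case using xy by simp
next
  case (Suc t)
  let ?F = "\<Pi>\<^sub>E s\<in>{1..t}. X s \<rightarrow>\<^sub>E X (s+1)"
  let ?H = "X (Suc t) \<rightarrow>\<^sub>E X (Suc (Suc t))"
  let ?q = "real (card (X (Suc (Suc t)))) ^ card (X (Suc t))
    * (1 - 1 / real (card (X (Suc (Suc t)))))"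
  have step: "(\<Sum>h\<in>?H. of_bool (h (comp_upto g t x) \<noteq> h (comp_upto g t y))) =
      of_bool (comp_upto g t x \<noteq> comp_upto g t y) * ?q" if "g \<in> ?F" for g
  proof (cases "comp_upto g t x = comp_upto g t y")
    case False
    have "g s \<in> X s \<rightarrow> X (s+1)" if "s \<in> {1..t}" for s
      using \<open>g \<in> ?F\<close> that by (auto simp: PiE_iff)
    then have "comp_upto g t x \<in> X (Suc t)" "comp_upto g t y \<in> X (Suc t)"
      using comp_upto_in[of t g X] xy by auto
    then show ?thesis
      using sum_funcset_separating[of "X (Suc t)" "X (Suc (Suc t))" "comp_upto g t x" "comp_upto g t y"]
        Suc.prems False by simp
  qed simp
  have prefix: "comp_upto (g(Suc t := h)) t = comp_upto g t" for g :: "nat \<Rightarrow> 'a \<Rightarrow> 'a" and h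
    by (rule comp_upto_cong) auto
  have "(\<Sum>f \<in> (\<Pi>\<^sub>E s\<in>{1..Suc t}. X s \<rightarrow>\<^sub>E X (s+1)).
        of_bool (comp_upto f (Suc t) x \<noteq> comp_upto f (Suc t) y)) =
      (\<Sum>g\<in>?F. of_bool (comp_upto g t x \<noteq> comp_upto g t y) * ?q)"
    unfolding sum_PiE_Suc using step by (intro sum.cong refl) (simp add: prefix)
  also have "\<dots> = (\<Sum>g\<in>?F. of_bool (comp_upto g t x \<noteq> comp_upto g t y)) * ?q"
    by (rule sum_distrib_right[symmetric])
  also have "(\<Sum>g\<in>?F. of_bool (comp_upto g t x \<noteq> comp_upto g t y)) =
      (\<Prod>s=1..t. real (card (X (s+1))) ^ card (X s)) * (\<Prod>s=1..t. 1 - 1 / real (card (X (s+1))))"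
    using Suc.prems by (intro Suc.IH) auto
  finally show ?case
    by (simp add: mult_ac)
qed

lemma deg_noninv_eq_sum_pairs:
  assumes "finite X"
  shows "deg_noninv X f = (1 / real (card X)) * (\<Sum>x\<in>X. \<Sum>y\<in>X. of_bool (f x = f y))"
  unfolding deg_noninv_def using assms by (simp add: Int_def eq_commute)

theorem theorem2p1:
  fixes t :: nat and X :: "nat \<Rightarrow> 'a set" and n :: "nat \<Rightarrow> nat"
  assumes "t \<ge> 1"
    and "\<And>s. s \<in> {1..t+1} \<Longrightarrow> finite (X s)"
    and "\<And>s. s \<in> {1..t+1} \<Longrightarrow> X s \<noteq> {}"
    and "\<And>s. s \<in> {1..t+1} \<Longrightarrow> card (X s) = n s"
  shows "mean_deg t X =
    ((\<Prod>s=1..t+1. real (n s)) - (\<Prod>s=1..t+1. (real (n s) - 1))) / (\<Prod>s=2..t+1. real (n s))"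
proof -
  let ?F = "\<Pi>\<^sub>E s\<in>{1..t}. X s \<rightarrow>\<^sub>E X (s+1)"
  define T where "T = (\<Prod>s=1..t. real (card (X (s+1))) ^ card (X s))"
  define P where "P = (\<Prod>s=1..t. 1 - 1 / real (card (X (s+1))))"
  define m where "m = real (n 1)"
  have pos: "n s > 0" if "s \<in> {1..t+1}" for s
    using assms(2,3,4)[OF that] by (metis card_gt_0_iff)
  have m: "m > 0"
    using pos[of 1] by (simp add: m_def)
  have X1: "finite (X 1)" "card (X 1) = n 1"
    using assms(2,4)[of 1] by auto
  have "card (X (s+1)) > 0" if "s \<in> {1..t}" for s
    using pos[of "s+1"] assms(4)[of "s+1"] that by auto
  then have T: "T \<noteq> 0"
    unfolding T_def by (subst prod_zero_iff) auto
  have cardF: "real (card ?F) = T"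
    unfolding T_def using assms(2) by (simp add: card_PiE card_funcsetE)
  have pair: "(\<Sum>f\<in>?F. of_bool (comp_upto f t x = comp_upto f t y)) = T - of_bool (x \<noteq> y) * (T * P)"
    if "x \<in> X 1" "y \<in> X 1" for x y
  proof -
    have "(\<Sum>f\<in>?F. of_bool (comp_upto f t x = comp_upto f t y)) =
        (\<Sum>f\<in>?F. 1 - (of_bool (comp_upto f t x \<noteq> comp_upto f t y) :: real))"
      by (intro sum.cong) auto
    also have "\<dots> = T - (\<Sum>f\<in>?F. of_bool (comp_upto f t x \<noteq> comp_upto f t y))"
      unfolding sum_subtractf by (simp only: sum_constant cardF mult_1_right)
    also have "\<dots> = T - of_bool (x \<noteq> y) * (T * P)"
      using sum_tuples_separating[of t X x y] assms(2,3) that by (cases "x = y") (auto simp: T_def P_def)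
    finally show ?thesis .
  qed
  have "(\<Sum>f\<in>?F. deg_noninv (X 1) (comp_upto f t)) =
      (1 / m) * (\<Sum>f\<in>?F. \<Sum>x\<in>X 1. \<Sum>y\<in>X 1. of_bool (comp_upto f t x = comp_upto f t y))"
    by (simp only: deg_noninv_eq_sum_pairs[OF X1(1)] X1(2) m_def sum_distrib_left)
  also have "(\<Sum>f\<in>?F. \<Sum>x\<in>X 1. \<Sum>y\<in>X 1. of_bool (comp_upto f t x = comp_upto f t y)) =
      (\<Sum>x\<in>X 1. \<Sum>y\<in>X 1. \<Sum>f\<in>?F. (of_bool (comp_upto f t x = comp_upto f t y) :: real))"
    by (subst sum.swap) (intro sum.cong refl sum.swap)
  also have "\<dots> = (\<Sum>x\<in>X 1. \<Sum>y\<in>X 1. T - of_bool (x \<noteq> y) * (T * P))"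
    by (intro sum.cong refl pair)
  also have "\<dots> = (\<Sum>x\<in>X 1. \<Sum>y\<in>X 1. (T - T * P) + (if x = y then T * P else 0))"
    by (intro sum.cong refl) auto
  also have "\<dots> = m * (m * (T - T * P)) + m * (T * P)"
    unfolding sum.distrib using X1 by (simp add: m_def)
  also have "1 / m * (m * (m * (T - T * P)) + m * (T * P)) = T * (m - (m - 1) * P)"
    using m by (simp add: field_simps)
  finally have "mean_deg t X = m - (m - 1) * P"
    using T unfolding mean_deg_def T_def[symmetric] by simp
  also have "P = (\<Prod>s=2..t+1. real (n s) - 1) / (\<Prod>s=2..t+1. real (n s))"
  proof -
    have "P = (\<Prod>s=1..t. (real (n (s+1)) - 1) / real (n (s+1)))"
      unfolding P_def
    proof (intro prod.cong refl)
      fix s assume "s \<in> {1..t}"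
      then show "1 - 1 / real (card (X (s+1))) = (real (n (s+1)) - 1) / real (n (s+1))"
        using pos[of "s+1"] assms(4)[of "s+1"] by (simp add: field_simps)
    qed
    also have "\<dots> = (\<Prod>s=1+1..t+1. (real (n s) - 1) / real (n s))"
      by (rule prod.shift_bounds_cl_nat_ivl[symmetric])
    finally show ?thesis
      by (simp add: prod_dividef numeral_2_eq_2)
  qed
  also have "m - (m - 1) * \<dots> =
      (m * (\<Prod>s=2..t+1. real (n s)) - (m - 1) * (\<Prod>s=2..t+1. real (n s) - 1)) /
        (\<Prod>s=2..t+1. real (n s))"
  proof -
    have "real (n s) > 0" if "s \<in> {2..t+1}" for s
      using pos[of s] that by auto
    then have "(\<Prod>s=2..t+1. real (n s)) > 0"
      by (rule prod_pos)
    then show ?thesis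
      by (simp add: diff_divide_distrib)
  qed
  also have "m * (\<Prod>s=2..t+1. real (n s)) = (\<Prod>s=1..t+1. real (n s))"
    using prod.atLeast_Suc_atMost[of 1 "t+1" "\<lambda>s. real (n s)"] by (simp add: m_def numeral_2_eq_2)
  also have "(m - 1) * (\<Prod>s=2..t+1. real (n s) - 1) = (\<Prod>s=1..t+1. real (n s) - 1)"
    using prod.atLeast_Suc_atMost[of 1 "t+1" "\<lambda>s. real (n s) - 1"] by (simp add: m_def numeral_2_eq_2)
  finally show ?thesis .
qed

end
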